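(* There exist an absolute constant $\gamma_0>0$ and absolute implied constants such that the following holds. Let $\rho=\beta+i\gamma$ be a complex zero of the Riemann zeta-function $\zeta(s)$ with $\beta\ge \frac12$ and $\gamma>\gamma_0$, and let $r=m(\beta+i\gamma)$ be its multiplicity. Let $k>0$, $0<\delta<\frac18$, and let $\ell=\ell(\gamma,\delta,k)>0$ be a number such that $$\int_\delta^{2\delta}|\zeta(\beta+i\gamma+i\alpha)|^k\,d\alpha\ \ge\ \ell .$$ Then $$m(\beta+i\gamma)=r\ \le\ \frac{1}{\log\left(\frac{1}{8\delta}\right)}\left(\log\gamma-\frac1k\log\ell+O(1)\right)+O(1).$$
   Context: $\zeta(s)$ is the Riemann zeta-function. The multiplicity $m(\rho)$ of a complex zero $\rho=\beta+i\gamma$ of $\zeta(s)$ is the integer $r\ge1$ with $\zeta(\rho)=\zeta'(\rho)=\dots=\zeta^{(r-1)}(\rho)=0$ and $\zeta^{(r)}(\rho)\ne0$. Each $O(1)$ denotes a quantity bounded in absolute value by an absolute constant. *)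

theory Defs
  imports "HOL-Complex_Analysis.Complex_Analysis"
begin

definition zeta_series :: "complex \<Rightarrow> complex" where
  "zeta_series s = (\<Sum>n. 1 / of_nat (Suc n) powr s)"

definition is_zeta :: "(complex \<Rightarrow> complex) \<Rightarrow> bool" where
  "is_zeta f \<longleftrightarrow> f holomorphic_on - {1} \<and> (\<forall>s. Re s > 1 \<longrightarrow> f s = zeta_series s) \<and> f 1 = 0"

(* The value 0 at the pole s = 1 is a convention that only serves to make the description
   unique; existence and uniqueness are shown in ex1_is_zeta below. *)
definition zeta :: "complex \<Rightarrow> complex" where
  "zeta = (THE f. is_zeta f)"

(* Well defined at every zero of zeta: see ex1_zero_multiplicity below. *)
definition zeta_mult :: "complex \<Rightarrow> nat" where
  "zeta_mult \<rho> = (THE r. r \<ge> 1 \<and> (\<forall>i<r. (deriv ^^ i) zeta \<rho> = 0) \<and> (deriv ^^ r) zeta \<rho> \<noteq> 0)"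

lemma norm_Suc_powr: "norm (of_nat (Suc n) powr s :: complex) = real (Suc n) powr Re s"
  using norm_powr_real_powr[of "of_nat (Suc n)" s] by (simp del: of_nat_Suc)

lemma summable_zeta_series:
  assumes "Re s > 1"
  shows "summable (\<lambda>n. 1 / of_nat (Suc n) powr s :: complex)"
proof (rule summable_norm_cancel)
  have "summable (\<lambda>n. real n powr (- Re s))"
    using assms by (simp add: summable_real_powr_iff)
  then have "summable (\<lambda>n. real (Suc n) powr (- Re s))"
    by (subst summable_Suc_iff)
  then show "summable (\<lambda>n. norm (1 / of_nat (Suc n) powr s :: complex))"
    by (simp only: norm_divide norm_Suc_powr norm_one powr_minus_divide)
qed

lemma Taylor_remainder_bound:
  fixes s :: complex
  assumes K: "Re s + real K > 0"
  shows "norm (of_nat (Suc (Suc n)) powr (1 - s)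
           - (\<Sum>i\<le>K. (\<Prod>j<i. 1 - s - of_nat j) * of_nat (Suc n) powr (1 - s - of_nat i) / fact i))
         \<le> norm (\<Prod>j<Suc K. 1 - s - of_nat j) * real (Suc n) powr (- (Re s + real K))"
proof -
  define f where "f = (\<lambda>i x. (\<Prod>j<i. 1 - s - of_nat j) * x powr (1 - s - of_nat i))"
  define S where "S = complex_of_real ` {real (Suc n)..real (Suc (Suc n))}"
  have S: "convex S"
    unfolding S_def by (intro convex_linear_image) (auto intro: bounded_linear.linear bounded_linear_of_real)
  have fd: "(f i has_field_derivative f (Suc i) x) (at x within S)" if "x \<in> S" for i x
  proof -
    have "x \<notin> \<real>\<^sub>\<le>\<^sub>0" using that by (auto simp: S_def complex_nonpos_Reals_iff)
    then have "((\<lambda>x. x powr (1 - s - of_nat i)) has_field_derivative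
             (1 - s - of_nat i) * x powr (1 - s - of_nat i - 1)) (at x within S)"
      by (rule has_field_derivative_powr [THEN has_field_derivative_at_within])
    from DERIV_cmult[OF this, of "\<Prod>j<i. 1 - s - of_nat j"] show ?thesis
      by (simp add: f_def mult.assoc diff_diff_eq add.commute)
  qed
  have B: "norm (f (Suc K) x)
       \<le> norm (\<Prod>j<Suc K. 1 - s - of_nat j) * real (Suc n) powr (- (Re s + real K))" if "x \<in> S" for x
  proof -
    from \<open>x \<in> S\<close> obtain y where y: "x = of_real y" "y \<ge> real (Suc n)" by (auto simp: S_def)
    then have "norm (x powr (1 - s - of_nat (Suc K))) = y powr (- (Re s + real K))"
      using norm_powr_real_powr[of x "1 - s - of_nat (Suc K)"] by (simp add: algebra_simps)
    also have "\<dots> \<le> real (Suc n) powr (- (Re s + real K))"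
      using y K by (intro powr_mono2') auto
    finally show ?thesis
      unfolding f_def norm_mult by (intro mult_left_mono) auto
  qed
  have "norm (f 0 (of_nat (Suc (Suc n)))
      - (\<Sum>i\<le>K. f i (of_nat (Suc n)) * (of_nat (Suc (Suc n)) - of_nat (Suc n)) ^ i / fact i))
      \<le> norm (\<Prod>j<Suc K. 1 - s - of_nat j) * real (Suc n) powr (- (Re s + real K))
         * norm (of_nat (Suc (Suc n)) - of_nat (Suc n) :: complex) ^ Suc K / fact K"
  proof (rule complex_Taylor[OF S])
    show "of_nat (Suc n) \<in> S"
      unfolding S_def by (rule image_eqI[of _ _ "real (Suc n)"]) auto
    show "of_nat (Suc (Suc n)) \<in> S"
      unfolding S_def by (rule image_eqI[of _ _ "real (Suc (Suc n))"]) auto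
  qed (use fd B in auto)
  also have "\<dots> \<le> norm (\<Prod>j<Suc K. 1 - s - of_nat j) * real (Suc n) powr (- (Re s + real K)) / 1"
  proof -
    have "norm (of_nat (Suc (Suc n)) - of_nat (Suc n) :: complex) = 1" by simp
    then show ?thesis by (simp only: power_one mult_1_right) (intro divide_left_mono, auto)
  qed
  finally show ?thesis by (simp add: f_def)
qed

lemma zeta_remainder_holomorphic:
  fixes K :: nat
  defines "R \<equiv> (\<lambda>n s. of_nat (Suc (Suc n)) powr (1 - s)
           - (\<Sum>i\<le>K. (\<Prod>j<i. 1 - s - of_nat j) * of_nat (Suc n) powr (1 - s - of_nat i) / fact i) :: complex)"
  shows "(\<lambda>s. \<Sum>n. R n s) holomorphic_on {s. Re s > 1 - real K}"
    and "\<And>s. Re s > 1 - real K \<Longrightarrow> summable (\<lambda>n. R n s)"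
proof -
  have op: "open {s. Re s > 1 - real K}" by (rule open_halfspace_Re_gt)
  have holR: "R n holomorphic_on UNIV" for n
    unfolding R_def by (intro holomorphic_intros) auto
  have main: "\<exists>d>0. cball x d \<subseteq> {s. Re s > 1 - real K} \<and>
       uniform_limit (cball x d) (\<lambda>m s. \<Sum>n<m. R n s) (\<lambda>s. \<Sum>n. R n s) sequentially \<and>
       summable (\<lambda>n. R n x)"
    if x: "Re x > 1 - real K" for x
  proof -
    define d where "d = (Re x - (1 - real K)) / 2"
    define a where "a = 1 - real K + d"
    have d: "d > 0" using x by (simp add: d_def)
    have re: "Re s \<ge> a" if "s \<in> cball x d" for s
      using that abs_Re_le_cmod[of "x - s"] by (simp add: dist_norm a_def d_def field_simps)
    have "continuous_on (cball x d) (\<lambda>s. \<Prod>j<Suc K. 1 - s - of_nat j :: complex)"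
      by (intro continuous_intros)
    then have "bounded ((\<lambda>s. \<Prod>j<Suc K. 1 - s - of_nat j :: complex) ` cball x d)"
      by (intro compact_imp_bounded compact_continuous_image) auto
    then obtain C where C: "\<And>s. s \<in> cball x d \<Longrightarrow> norm (\<Prod>j<Suc K. 1 - s - of_nat j :: complex) \<le> C"
      unfolding bounded_iff by blast
    have C0: "C \<ge> 0" using C[of x] d by (meson centre_in_cball less_imp_le norm_ge_zero order_trans)
    have bd: "norm (R n s) \<le> C * real (Suc n) powr (- (a + real K))" if s: "s \<in> cball x d" for n s
    proof -
      have "norm (R n s) \<le> norm (\<Prod>j<Suc K. 1 - s - of_nat j) * real (Suc n) powr (- (Re s + real K))"
        unfolding R_def by (rule Taylor_remainder_bound) (use re[OF s] d in \<open>simp add: a_def\<close>)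
      also have "\<dots> \<le> C * real (Suc n) powr (- (a + real K))"
        by (intro mult_mono C s powr_mono C0) (use re[OF s] in auto)
      finally show ?thesis .
    qed
    have "summable (\<lambda>n. real n powr (- (a + real K)))"
      using d by (simp add: summable_real_powr_iff a_def)
    then have sm: "summable (\<lambda>n. C * real (Suc n) powr (- (a + real K)))"
      by (intro summable_mult) (subst summable_Suc_iff)
    have "uniform_limit (cball x d) (\<lambda>m s. \<Sum>n<m. R n s) (\<lambda>s. \<Sum>n. R n s) sequentially"
      using bd sm by (rule Weierstrass_m_test)
    moreover have "summable (\<lambda>n. R n x)"
      using sm bd[of x] d by (intro summable_comparison_test[OF _ sm]) auto
    moreover have "cball x d \<subseteq> {s. Re s > 1 - real K}"
      using re d by (force simp: a_def)
    ultimately show ?thesis using d by blast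
  qed
  show "(\<lambda>s. \<Sum>n. R n s) holomorphic_on {s. Re s > 1 - real K}"
  proof (rule holomorphic_uniform_sequence[OF op, where f = "\<lambda>m s. \<Sum>n<m. R n s"])
    show "(\<lambda>s. \<Sum>n<m. R n s) holomorphic_on {s. Re s > 1 - real K}" for m
      by (intro holomorphic_intros holomorphic_on_subset[OF holR]) auto
  qed (use main in blast)
  show "summable (\<lambda>n. R n s)" if "Re s > 1 - real K" for s
    using main[OF that] by blast
qed

lemma zeta_series_recursion:
  assumes s: "Re s > 1" and K: "K \<ge> 1"
  shows "(s - 1) * zeta_series s =
    1 + (\<Sum>n. of_nat (Suc (Suc n)) powr (1 - s)
           - (\<Sum>i\<le>K. (\<Prod>j<i. 1 - s - of_nat j) * of_nat (Suc n) powr (1 - s - of_nat i) / fact i))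
      + (\<Sum>i\<in>{2..K}. (\<Prod>j<i. 1 - s - of_nat j) / fact i * zeta_series (s + of_nat i - 1))"
proof -
  define c where "c = (\<lambda>i. (\<Prod>j<i. 1 - s - of_nat j) / fact i)"
  define p where "p = (\<lambda>n. of_nat (Suc n) powr (1 - s) :: complex)"
  have "(\<lambda>n. real (Suc n) powr (1 - Re s)) \<longlonglongrightarrow> 0"
    using s by real_asymp
  then have "(\<lambda>n. norm (p n)) \<longlonglongrightarrow> 0"
    by (simp add: p_def norm_Suc_powr del: of_nat_Suc)
  then have "p \<longlonglongrightarrow> 0" by (rule tendsto_norm_zero_cancel)
  then have tel: "(\<lambda>n. p (Suc n) - p n) sums (0 - p 0)" by (rule telescope_sums)
  have ser: "(\<lambda>n. of_nat (Suc n) powr (1 - s - of_nat i)) sums zeta_series (s + of_nat i - 1)"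
    if "i \<ge> 1" for i
  proof -
    have "of_nat (Suc n) powr (1 - s - of_nat i) = 1 / of_nat (Suc n) powr (s + of_nat i - 1 :: complex)" for n
      by (subst powr_minus_divide [symmetric]) (simp add: algebra_simps)
    then show ?thesis
      using summable_zeta_series[of "s + of_nat i - 1"] s that
      by (simp add: zeta_series_def summable_sums del: of_nat_Suc)
  qed
  have "(\<lambda>n. (p (Suc n) - p n) - (\<Sum>i\<in>{1..K}. c i * of_nat (Suc n) powr (1 - s - of_nat i)))
     sums ((0 - p 0) - (\<Sum>i\<in>{1..K}. c i * zeta_series (s + of_nat i - 1)))"
    by (intro sums_diff tel sums_sum sums_mult ser) auto
  moreover have eq: "(p (Suc n) - p n) - (\<Sum>i\<in>{1..K}. c i * of_nat (Suc n) powr (1 - s - of_nat i))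
     = of_nat (Suc (Suc n)) powr (1 - s)
           - (\<Sum>i\<le>K. (\<Prod>j<i. 1 - s - of_nat j) * of_nat (Suc n) powr (1 - s - of_nat i) / fact i)" for n
  proof -
    have "{..K} = insert 0 {1..K}" by auto
    then show ?thesis by (simp add: p_def c_def del: of_nat_Suc)
  qed
  ultimately have g1: "(\<Sum>n. of_nat (Suc (Suc n)) powr (1 - s)
           - (\<Sum>i\<le>K. (\<Prod>j<i. 1 - s - of_nat j) * of_nat (Suc n) powr (1 - s - of_nat i) / fact i))
        = - 1 - (\<Sum>i\<in>{1..K}. c i * zeta_series (s + of_nat i - 1))"
    unfolding eq by (simp add: sums_iff p_def)
  have "{1..K} = insert 1 {2..K}" using K by auto
  then have g2: "(\<Sum>i\<in>{1..K}. c i * zeta_series (s + of_nat i - 1))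
     = (1 - s) * zeta_series s + (\<Sum>i\<in>{2..K}. c i * zeta_series (s + of_nat i - 1))"
    by (simp add: c_def)
  show ?thesis unfolding g1 g2 by (simp add: c_def algebra_simps)
qed

lemma zeta_half_plane:
  "\<exists>Z. Z holomorphic_on {s. Re s > 1 - real K} \<and> (\<forall>s. Re s > 1 \<longrightarrow> Z s = (s - 1) * zeta_series s)"
proof (induction K)
  case 0
  have "zeta_series holomorphic_on {s. Re s > 1}"
  proof (rule holomorphic_uniform_sequence[OF open_halfspace_Re_gt])
    show "(\<lambda>s. \<Sum>n<m. 1 / of_nat (Suc n) powr s) holomorphic_on {s. Re s > 1}" for m
      by (intro holomorphic_intros) auto
    fix x :: complex assume "x \<in> {s. Re s > 1}"
    then have x: "Re x > 1" by simp
    define d where "d = (Re x - 1) / 2"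
    have d: "d > 0" using x by (simp add: d_def)
    have re: "Re s \<ge> 1 + d" if "s \<in> cball x d" for s
      using that abs_Re_le_cmod[of "x - s"] by (simp add: dist_norm d_def field_simps)
    have bd: "norm (1 / of_nat (Suc n) powr s :: complex) \<le> real (Suc n) powr (- (1 + d))"
      if s: "s \<in> cball x d" for n s
    proof -
      have "norm (1 / of_nat (Suc n) powr s :: complex) = real (Suc n) powr (- Re s)"
        by (simp only: norm_divide norm_Suc_powr norm_one powr_minus_divide)
      also have "\<dots> \<le> real (Suc n) powr (- (1 + d))"
        by (intro powr_mono) (use re[OF s] in auto)
      finally show ?thesis .
    qed
    have "summable (\<lambda>n. real n powr (- (1 + d)))"
      using d by (simp add: summable_real_powr_iff)
    then have sm: "summable (\<lambda>n. real (Suc n) powr (- (1 + d)))"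
      by (subst summable_Suc_iff)
    have "uniform_limit (cball x d) (\<lambda>m s. \<Sum>n<m. 1 / of_nat (Suc n) powr s) zeta_series sequentially"
      unfolding zeta_series_def using bd sm by (rule Weierstrass_m_test)
    moreover have "cball x d \<subseteq> {s. Re s > 1}" using re d by force
    ultimately show "\<exists>d>0. cball x d \<subseteq> {s. Re s > 1} \<and>
       uniform_limit (cball x d) (\<lambda>m s. \<Sum>n<m. 1 / of_nat (Suc n) powr s) zeta_series sequentially"
      using d by blast
  qed
  then have "(\<lambda>s. (s - 1) * zeta_series s) holomorphic_on {s. Re s > 1}"
    by (intro holomorphic_intros)
  then show ?case by auto
next
  case (Suc N)
  then obtain Z where Z: "Z holomorphic_on {s. Re s > 1 - real N}"
    and Zs: "\<And>s. Re s > 1 \<Longrightarrow> Z s = (s - 1) * zeta_series s" by blast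
  define K where "K = Suc N"
  define R where "R = (\<lambda>n s. of_nat (Suc (Suc n)) powr (1 - s)
     - (\<Sum>i\<le>K. (\<Prod>j<i. 1 - s - of_nat j) * of_nat (Suc n) powr (1 - s - of_nat i) / fact i) :: complex)"
  define Y where "Y = (\<lambda>s. 1 + (\<Sum>n. R n s)
     + (\<Sum>i\<in>{2..K}. - (\<Prod>j<i - 1. 1 - s - of_nat j) / fact i * Z (s + of_nat i - 1)))"
  have "(\<lambda>s. Z (s + of_nat i - 1)) holomorphic_on {s. Re s > 1 - real K}" if "i \<in> {2..K}" for i
    by (rule holomorphic_on_compose_gen[OF _ Z, unfolded o_def])
       (use that in \<open>auto intro!: holomorphic_intros simp: K_def\<close>)
  moreover have G: "(\<lambda>s. \<Sum>n. R n s) holomorphic_on {s. Re s > 1 - real K}"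
    unfolding R_def by (rule zeta_remainder_holomorphic)
  ultimately have "Y holomorphic_on {s. Re s > 1 - real K}"
    unfolding Y_def
    by (intro holomorphic_intros G) auto
  moreover have "Y s = (s - 1) * zeta_series s" if s: "Re s > 1" for s
  proof -
    have "- (\<Prod>j<i - 1. 1 - s - of_nat j) / fact i * Z (s + of_nat i - 1)
        = (\<Prod>j<i. 1 - s - of_nat j) / fact i * zeta_series (s + of_nat i - 1)" if "i \<in> {2..K}" for i
    proof -
      have "i \<noteq> 0" using that by simp
      then obtain m where m: "i = Suc m" using not0_implies_Suc by blast
      have Zi: "Z (s + of_nat i - 1) = (s + of_nat i - 1 - 1) * zeta_series (s + of_nat i - 1)"
        by (rule Zs) (use that s in auto)
      have pr: "(\<Prod>j<i. 1 - s - of_nat j) = - (s + of_nat i - 1 - 1) * (\<Prod>j<i - 1. 1 - s - of_nat j)"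
        by (simp add: m algebra_simps)
      have "- P / c * (a * z) = (- a * P) / c * z" for P c a z :: complex
        by simp
      then show ?thesis unfolding Zi pr .
    qed
    then have "Y s = 1 + (\<Sum>n. R n s)
       + (\<Sum>i\<in>{2..K}. (\<Prod>j<i. 1 - s - of_nat j) / fact i * zeta_series (s + of_nat i - 1))"
      unfolding Y_def by (intro arg_cong2[where f = "(+)"] refl sum.cong) auto
    then show ?thesis
      unfolding R_def using zeta_series_recursion[OF s, of K] by (simp add: K_def)
  qed
  ultimately show ?case unfolding K_def by blast
qed

theorem ex1_is_zeta: "\<exists>!f. is_zeta f"
proof -
  obtain Z where Z: "\<And>K. Z K holomorphic_on {s. Re s > 1 - real K}"
    and Zs: "\<And>K s. Re s > 1 \<Longrightarrow> Z K s = (s - 1) * zeta_series s"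
    using zeta_half_plane by metis
  have Zeq: "Z K s = Z L s" if "K \<le> L" "Re s > 1 - real K" for K L s
  proof (rule analytic_continuation_open[of "{s. Re s > 1}" "{s. Re s > 1 - real K}" "Z K" "Z L"])
    show "{s. Re s > 1} \<noteq> {}" by (auto intro: exI[of _ "2::complex"])
    show "connected {s. Re s > 1 - real K}"
      by (intro convex_connected convex_halfspace_Re_gt)
    show "Z L holomorphic_on {s. Re s > 1 - real K}"
      by (rule holomorphic_on_subset[OF Z]) (use that in auto)
  qed (use that Z Zs in \<open>auto simp: open_halfspace_Re_gt\<close>)
  define N where "N = (\<lambda>s. nat \<lceil>2 - Re s\<rceil>)"
  have N: "Re s > 1 - real (N s)" for s
    unfolding N_def by linarith
  define W where "W = (\<lambda>s. Z (N s) s)"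
  have WZ: "W s = Z K s" if "Re s > 1 - real K" for s K
    unfolding W_def using Zeq N that by (metis linear)
  have Wd: "W field_differentiable at s" for s
  proof -
    have "W holomorphic_on {z. Re z > 1 - real (N s)}"
      using Z[of "N s"] by (rule holomorphic_transform) (simp only: WZ mem_Collect_eq)
    then show ?thesis
      by (rule holomorphic_on_imp_differentiable_at) (use N[of s] in \<open>simp_all add: open_halfspace_Re_gt\<close>)
  qed
  define f where "f = (\<lambda>s. W s / (s - 1))"
  have "W holomorphic_on - {1}"
    using Wd by (auto simp: holomorphic_on_def field_differentiable_at_within)
  then have "f holomorphic_on - {1}"
    unfolding f_def by (intro holomorphic_intros) auto
  moreover have "f s = zeta_series s" if "Re s > 1" for s
    using WZ[of 0 s] Zs[of s 0] that by (auto simp: f_def)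
  ultimately have f: "is_zeta f" by (simp add: is_zeta_def f_def)
  show ?thesis
  proof (rule ex1I[of _ f])
    fix g assume g: "is_zeta g"
    show "g = f"
    proof
      fix s
      show "g s = f s"
      proof (cases "s = 1")
        case False
        show ?thesis
        proof (rule analytic_continuation_open[of "{s. Re s > 1}" "- {1}" g f])
          show "{s. Re s > 1} \<noteq> {}" by (auto intro: exI[of _ "2::complex"])
          show "connected (- {1 :: complex})"
            by (rule connected_punctured_universe) simp
        qed (use f g False in \<open>auto simp: is_zeta_def open_halfspace_Re_gt\<close>)
      qed (use f g in \<open>simp add: is_zeta_def\<close>)
    qed
  qed (rule f)
qed

lemma is_zeta_zeta: "is_zeta zeta"
  unfolding zeta_def by (rule theI'[OF ex1_is_zeta])

lemma holomorphic_zeta: "zeta holomorphic_on - {1}"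
  and zeta_eq_series: "Re s > 1 \<Longrightarrow> zeta s = (\<Sum>n. 1 / of_nat (Suc n) powr s)"
  using is_zeta_zeta by (auto simp: is_zeta_def zeta_series_def)

lemma zeta_2_nonzero: "zeta 2 \<noteq> 0"
proof -
  have eq: "Re (1 / of_nat (Suc n) powr 2) = 1 / real (Suc n) powr 2" for n
  proof -
    have "of_nat (Suc n) powr 2 = complex_of_real (real (Suc n) powr 2)"
      using powr_of_real[of "real (Suc n)" 2] by (simp del: of_nat_Suc)
    then have "1 / of_nat (Suc n) powr 2 = complex_of_real (1 / real (Suc n) powr 2)"
      by (simp only: of_real_divide of_real_1)
    then show ?thesis by (simp only: Re_complex_of_real)
  qed
  have sm: "summable (\<lambda>n. 1 / of_nat (Suc n) powr 2 :: complex)"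
    by (rule summable_zeta_series) simp
  have "Re (zeta 2) = (\<Sum>n. Re (1 / of_nat (Suc n) powr 2))"
    using sm by (simp add: zeta_eq_series Re_suminf)
  also have "\<dots> > 0"
  proof (rule suminf_pos[OF summable_Re[OF sm]])
    show "0 < Re (1 / of_nat (Suc n) powr 2)" for n
      unfolding eq by (simp del: of_nat_Suc)
  qed
  finally show ?thesis by auto
qed

theorem ex1_zero_multiplicity:
  assumes "zeta \<rho> = 0" "\<rho> \<noteq> 1"
  shows "\<exists>!r. r \<ge> 1 \<and> (\<forall>i<r. (deriv ^^ i) zeta \<rho> = 0) \<and> (deriv ^^ r) zeta \<rho> \<noteq> 0"
proof -
  have ex: "\<exists>r. (deriv ^^ r) zeta \<rho> \<noteq> 0"
  proof (rule ccontr)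
    assume "\<not> ?thesis"
    then have "zeta 2 = 0"
      using assms connected_punctured_universe[of "1 :: complex"]
      by (intro holomorphic_fun_eq_0_on_connected[OF holomorphic_zeta, where z = \<rho>]) auto
    then show False using zeta_2_nonzero by simp
  qed
  define r where "r = (LEAST r. (deriv ^^ r) zeta \<rho> \<noteq> 0)"
  have r: "(deriv ^^ r) zeta \<rho> \<noteq> 0" unfolding r_def using ex by (rule LeastI_ex)
  have lt: "(deriv ^^ i) zeta \<rho> = 0" if "i < r" for i
    using that not_less_Least unfolding r_def by blast
  have "r \<noteq> 0" using r assms(1) by (intro notI) simp
  show ?thesis
  proof (rule ex1I[of _ r])
    fix r' assume "r' \<ge> 1 \<and> (\<forall>i<r'. (deriv ^^ i) zeta \<rho> = 0) \<and> (deriv ^^ r') zeta \<rho> \<noteq> 0"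
    then show "r' = r" using r lt by (metis linorder_less_linear)
  qed (use r lt \<open>r \<noteq> 0\<close> in auto)
qed

end

(* If zeta vanishes to order r at \<rho>, then zeta s / (s - \<rho>) ^ r is holomorphic, and the maximum
   principle on the disc of radius 1/4 about \<rho>, where zeta is O(\<gamma>), gives
   |zeta (\<rho> + i \<alpha>)| \<le> (4 \<alpha>) ^ r O(\<gamma>) \<le> (8 \<delta>) ^ r O(\<gamma>) for \<delta> \<le> \<alpha> \<le> 2 \<delta>.
   Integrating the k-th power and taking logarithms bounds r. *)

theory Submission
  imports Defs
begin

text \<open>A Schwarz lemma for a zero of order at least \<open>r\<close>: the quotient of
  \<open>f\<close> by \<open>(w - z) ^ r\<close> extends holomorphically over \<open>z\<close> and
  has norm at most \<open>M / R ^ r\<close> on the sphere, hence on the whole disc. The larger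
  radius \<open>R'\<close> makes everything holomorphic up to the boundary.\<close>

lemma norm_le_of_high_order_zero:
  assumes hol: "f holomorphic_on ball z R'" and R: "0 < R" "R < R'"
    and zero: "\<And>i. i < r \<Longrightarrow> (deriv ^^ i) f z = 0"
    and bd: "\<And>w. w \<in> sphere z R \<Longrightarrow> norm (f w) \<le> M"
    and w: "w \<in> cball z R"
  shows "norm (f w) \<le> (dist z w / R) ^ r * M"
proof -
  define a where "a = (\<lambda>n. (deriv ^^ n) f z / fact n)"
  \<comment> \<open>The value \<open>a r\<close> at \<open>z\<close> removes the singularity: the
    power series of \<open>g\<close> is that of \<open>f\<close> with its \<open>r\<close> vanishing
    leading terms dropped and the index shifted by \<open>r\<close>.\<close>
  define g where "g = (\<lambda>w. if w = z then a r else f w / (w - z) ^ r)"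
  have fs: "(\<lambda>n. a n * (w - z) ^ n) sums f w" if "w \<in> ball z R'" for w
    unfolding a_def by (rule holomorphic_power_series[OF hol that])
  have "g holomorphic_on ball z R'"
  proof (rule power_series_holomorphic)
    fix w assume w: "w \<in> ball z R'"
    show "(\<lambda>n. a (n + r) * (w - z) ^ n) sums g w"
    proof (cases "w = z")
      case True
      then show ?thesis
        using sums_finite[of "{0}" "\<lambda>n. a (n + r) * (w - z) ^ n"] by (simp add: g_def)
    next
      case False
      have "(\<Sum>i<r. a i * (w - z) ^ i) = 0"
        by (intro sum.neutral) (simp add: a_def zero)
      then have "(\<lambda>n. a (n + r) * (w - z) ^ (n + r)) sums f w"
        using fs[OF w] sums_iff_shift[of "\<lambda>n. a n * (w - z) ^ n" r "f w"] by simp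
      from sums_divide[OF this, of "(w - z) ^ r"] show ?thesis
        using False by (simp add: g_def power_add)
    qed
  qed
  then have holg: "g holomorphic_on cball z R"
    by (rule holomorphic_on_subset) (use R in auto)
  have fg: "f w = (w - z) ^ r * g w" if "w \<in> ball z R'" for w
  proof (cases "w = z")
    case True
    \<comment> \<open>At the centre \<open>(w - z) ^ r\<close> is 0 for \<open>r > 0\<close> but 1
      for \<open>r = 0\<close>, so the two cases need different reasons.\<close>
    have "f z = 0" if "r > 0" using zero[of 0] that by simp
    moreover have "f z = a r" if "r = 0" using that by (simp add: a_def)
    ultimately show ?thesis using True by (cases "r = 0") (auto simp: g_def)
  qed (simp add: g_def)
  have gw: "norm (g w) \<le> M / R ^ r"
  proof (rule maximum_modulus_frontier[of g "cball z R"])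
    show "g holomorphic_on interior (cball z R)"
      by (rule holomorphic_on_subset[OF holg interior_subset])
    show "continuous_on (closure (cball z R)) g"
      using holg by (simp add: holomorphic_on_imp_continuous_on)
    fix x assume "x \<in> frontier (cball z R)"
    then have x: "dist z x = R" using R by simp
    then have "norm (f x) = R ^ r * norm (g x)"
      using fg[of x] R by (simp add: norm_mult norm_power dist_norm norm_minus_commute)
    with bd[of x] x R show "norm (g x) \<le> M / R ^ r"
      by (simp add: field_simps)
  qed (use w in auto)
  have "norm (f w) = dist z w ^ r * norm (g w)"
    using fg[of w] w R by (simp add: norm_mult norm_power dist_norm norm_minus_commute)
  also have "\<dots> \<le> dist z w ^ r * (M / R ^ r)"
    by (intro mult_left_mono gw) auto
  finally show ?thesis by (simp add: power_divide)
qed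

lemma summable_Suc_powr:
  assumes "a > 1"
  shows "summable (\<lambda>n. real (Suc n) powr (- a))"
  using assms by (subst summable_Suc_iff) (simp add: summable_real_powr_iff)

text \<open>First-order Taylor remainders of \<open>x powr (1 - s)\<close> between consecutive
  integers decay like \<open>n powr (- (Re s + 1))\<close>. Their sum therefore converges for
  \<open>Re s > 0\<close> and continues \<open>(s - 1) * zeta s - 1\<close> there.\<close>

lemma zeta_half_plane_bound:
  assumes s: "Re s > 0" "s \<noteq> 1"
  shows "norm (zeta s) \<le> 1 / norm (s - 1) + norm s * (\<Sum>n. real (Suc n) powr (- (Re s + 1)))"
proof -
  define R :: "nat \<Rightarrow> complex \<Rightarrow> complex" where
    "R = (\<lambda>n s. of_nat (Suc (Suc n)) powr (1 - s)
       - (\<Sum>i\<le>1. (\<Prod>j<i. 1 - s - of_nat j) * of_nat (Suc n) powr (1 - s - of_nat i) / fact i))"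
  have hol: "(\<lambda>s. \<Sum>n. R n s) holomorphic_on {s. Re s > 0}"
    unfolding R_def using zeta_remainder_holomorphic(1)[of 1] by simp
  \<comment> \<open>For \<open>Re s > 1\<close> this is the recursion with \<open>K = 1\<close>,
    whose last sum runs over the empty set \<open>{2..1}\<close>. The half-plane stays connected
    without the point 1, so the identity extends.\<close>
  have eq: "(s - 1) * zeta s = 1 + (\<Sum>n. R n s)"
  proof (rule analytic_continuation_open[of "{s. Re s > 1}" "{s. Re s > 0} - {1}"
           "\<lambda>s. (s - 1) * zeta s" "\<lambda>s. 1 + (\<Sum>n. R n s)"])
    show "{s. Re s > 1} \<noteq> {}" by (auto intro: exI[of _ "2::complex"])
    show "open ({s. Re s > 0} - {1 :: complex})"
      by (intro open_Diff open_halfspace_Re_gt) auto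
    show "connected ({s. Re s > 0} - {1 :: complex})"
      by (intro connected_open_delete open_halfspace_Re_gt convex_connected convex_halfspace_Re_gt) auto
    show "(\<lambda>s. (s - 1) * zeta s) holomorphic_on {s. Re s > 0} - {1}"
      by (intro holomorphic_intros holomorphic_on_subset[OF holomorphic_zeta]) auto
    show "(\<lambda>s. 1 + (\<Sum>n. R n s)) holomorphic_on {s. Re s > 0} - {1}"
      by (intro holomorphic_intros holomorphic_on_subset[OF hol]) auto
    show "(z - 1) * zeta z = 1 + (\<Sum>n. R n z)" if "z \<in> {s. Re s > 1}" for z
      using zeta_series_recursion[of z 1] is_zeta_zeta that by (simp add: R_def is_zeta_def)
  qed (use s in \<open>auto simp: open_halfspace_Re_gt\<close>)
  define q where "q = (\<lambda>n. real (Suc n) powr (- (Re s + 1)))"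
  have q: "summable q" unfolding q_def by (rule summable_Suc_powr) (use s in simp)
  \<comment> \<open>The product over \<open>j < 2\<close> in the Taylor bound is
    \<open>(1 - s) * (- s)\<close>. Its factor \<open>s - 1\<close> cancels at the end.\<close>
  have "norm (R n s) \<le> norm (s - 1) * norm s * q n" for n
    using Taylor_remainder_bound[of s 1 n] s
    by (simp add: R_def q_def norm_mult norm_minus_commute)
  then have "norm (\<Sum>n. R n s) \<le> (\<Sum>n. norm (s - 1) * norm s * q n)"
    by (intro norm_suminf_le summable_mult q) auto
  also have "\<dots> = norm (s - 1) * norm s * suminf q"
    by (rule suminf_mult[OF q])
  finally have "norm ((s - 1) * zeta s) \<le> 1 + norm (s - 1) * norm s * suminf q"
    unfolding eq by (intro norm_triangle_le) simp
  then have "norm (s - 1) * norm (zeta s) \<le> norm (s - 1) * (1 / norm (s - 1) + norm s * suminf q)"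
    using s by (simp add: norm_mult distrib_left)
  then show ?thesis
    using s by (simp add: q_def)
qed

text \<open>The region is chosen to contain the disc of radius 1/4 about any point with real part at
  least 1/2 and imaginary part \<open>t\<close>.\<close>

lemma zeta_linear_bound:
  obtains C where "C > 0"
    and "\<And>s t. Re s \<ge> 1/4 \<Longrightarrow> t \<ge> 1 \<Longrightarrow> \<bar>Im s - t\<bar> \<le> 1/4 \<Longrightarrow> norm (zeta s) \<le> C * t"
proof -
  define A where "A = (\<Sum>n. real (Suc n) powr (- (5/4)))"
  have sA: "summable (\<lambda>n. real (Suc n) powr (- (5/4)))"
    by (rule summable_Suc_powr) simp
  have A: "A \<ge> 0" unfolding A_def by (intro suminf_nonneg sA) auto
  \<comment> \<open>The term 4/3 comes from the pole, as \<open>norm (s - 1)\<close> is at least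
    \<open>t - 1/4\<close>, hence at least 3/4. The factor 5/2 comes from \<open>norm s\<close>,
    which for \<open>Re s < 5/4\<close> is at most \<open>5/4 + (t + 1/4)\<close>, and
    \<open>t \<ge> 1\<close>.\<close>
  have "norm (zeta s) \<le> (4/3 + 5/2 * A) * t"
    if s: "Re s \<ge> 1/4" and t: "t \<ge> 1" "\<bar>Im s - t\<bar> \<le> 1/4" for s t
  \<comment> \<open>Far to the right \<open>norm s\<close> is not controlled by \<open>t\<close>,
    but there the Dirichlet series is bounded by \<open>A\<close>. Otherwise
    \<open>Re s + 1 \<ge> 5/4\<close> lets the same \<open>A\<close> bound the remainder
    sum.\<close>
  proof (cases "Re s \<ge> 5/4")
    case True
    have "norm (1 / of_nat (Suc n) powr s :: complex) \<le> real (Suc n) powr (- (5/4))" for n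
    proof -
      have "norm (1 / of_nat (Suc n) powr s :: complex) = real (Suc n) powr (- Re s)"
        by (simp only: norm_divide norm_Suc_powr norm_one powr_minus_divide)
      also have "\<dots> \<le> real (Suc n) powr (- (5/4))"
        using True by (intro powr_mono) auto
      finally show ?thesis .
    qed
    then have "norm (zeta s) \<le> A"
      using True unfolding A_def
      by (subst zeta_eq_series) (auto intro!: norm_suminf_le sA simp del: of_nat_Suc)
    also have "\<dots> \<le> (4/3 + 5/2 * A) * 1" using A by simp
    also have "\<dots> \<le> (4/3 + 5/2 * A) * t" using A t by (intro mult_left_mono) auto
    finally show ?thesis .
  next
    case False
    have im: "3/4 \<le> norm (s - 1)"
      using abs_Im_le_cmod[of "s - 1"] t unfolding minus_complex.sel one_complex.sel by linarith
    have "(\<Sum>n. real (Suc n) powr (- (Re s + 1))) \<le> A"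
      unfolding A_def
      by (intro suminf_le summable_Suc_powr powr_mono) (use s in auto)
    moreover have "norm s \<le> 5/2 * t"
      using cmod_le[of s] s False t by linarith
    ultimately have "norm s * (\<Sum>n. real (Suc n) powr (- (Re s + 1))) \<le> 5/2 * t * A"
      using s t by (intro mult_mono suminf_nonneg summable_Suc_powr) auto
    moreover have "1 / norm (s - 1) \<le> 4/3"
    proof -
      have "1 / norm (s - 1) \<le> 1 / (3/4)"
        using im by (intro divide_left_mono) auto
      then show ?thesis by simp
    qed
    moreover have "norm (zeta s) \<le> 1 / norm (s - 1) + norm s * (\<Sum>n. real (Suc n) powr (- (Re s + 1)))"
      using s im by (intro zeta_half_plane_bound) auto
    ultimately have "norm (zeta s) \<le> 4/3 * 1 + 5/2 * t * A" by simp
    also have "\<dots> \<le> 4/3 * t + 5/2 * t * A" using t by simp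
    finally show ?thesis by (simp add: algebra_simps)
  qed
  then show thesis using A by (intro that[of "4/3 + 5/2 * A"]) auto
qed

text \<open>The two O(1) terms are the reals \<open>E1\<close> and \<open>E2\<close>; absoluteness
  of the constants is expressed by choosing \<open>\<gamma>0\<close>, \<open>C1\<close> and
  \<open>C2\<close> before all parameters.\<close>

theorem theorem1:
  shows "\<exists>\<gamma>0 > 0. \<exists>C1 C2 :: real. \<forall>(\<beta> :: real) (\<gamma> :: real) (k :: real) (\<delta> :: real) (l :: real).
     \<beta> \<ge> 1/2 \<longrightarrow> \<gamma> > \<gamma>0 \<longrightarrow> zeta (Complex \<beta> \<gamma>) = 0 \<longrightarrow>
     k > 0 \<longrightarrow> 0 < \<delta> \<longrightarrow> \<delta> < 1/8 \<longrightarrow> l > 0 \<longrightarrow>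
     integral {\<delta>..2*\<delta>} (\<lambda>\<alpha>. norm (zeta (Complex \<beta> \<gamma> + \<i> * of_real \<alpha>)) powr k) \<ge> l \<longrightarrow>
     (\<exists>E1 E2. \<bar>E1\<bar> \<le> C1 \<and> \<bar>E2\<bar> \<le> C2 \<and>
        real (zeta_mult (Complex \<beta> \<gamma>)) \<le> 1 / ln (1 / (8*\<delta>)) * (ln \<gamma> - 1/k * ln l + E1) + E2)"
proof -
  obtain C where C: "C > 0"
    and zb: "\<And>s t. Re s \<ge> 1/4 \<Longrightarrow> t \<ge> 1 \<Longrightarrow> \<bar>Im s - t\<bar> \<le> 1/4 \<Longrightarrow> norm (zeta s) \<le> C * t"
    using zeta_linear_bound by blast
  have main: "real (zeta_mult (Complex \<beta> \<gamma>)) \<le> 1 / ln (1 / (8*\<delta>)) * (ln \<gamma> - 1/k * ln l + ln C)"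
    if \<beta>: "\<beta> \<ge> 1/2" and \<gamma>: "\<gamma> > 1" and z: "zeta (Complex \<beta> \<gamma>) = 0" and k: "k > 0"
      and \<delta>: "0 < \<delta>" "\<delta> < 1/8" and l: "l > 0"
      and int: "integral {\<delta>..2*\<delta>} (\<lambda>\<alpha>. norm (zeta (Complex \<beta> \<gamma> + \<i> * of_real \<alpha>)) powr k) \<ge> l"
    for \<beta> \<gamma> k \<delta> l :: real
  proof -
    define \<rho> where "\<rho> = Complex \<beta> \<gamma>"
    define r where "r = zeta_mult \<rho>"
    define F where "F = (\<lambda>\<alpha>. norm (zeta (\<rho> + \<i> * of_real \<alpha>)) powr k)"
    define B where "B = (8 * \<delta>) ^ r * (C * \<gamma>)"
    have B: "B > 0" using \<delta> C \<gamma> by (simp add: B_def)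
    have "\<rho> \<noteq> 1" using \<gamma> by (auto simp: \<rho>_def complex_eq_iff)
    with z have "r \<ge> 1 \<and> (\<forall>i<r. (deriv ^^ i) zeta \<rho> = 0) \<and> (deriv ^^ r) zeta \<rho> \<noteq> 0"
      unfolding r_def zeta_mult_def \<rho>_def by (intro theI'[OF ex1_zero_multiplicity])
    then have zero: "(deriv ^^ i) zeta \<rho> = 0" if "i < r" for i using that by blast
    \<comment> \<open>Since \<open>\<gamma> > 1\<close>, the pole lies at distance more than 1 from
      \<open>\<rho>\<close>; any radius between 1/4 and 1 would serve.\<close>
    have hol: "zeta holomorphic_on ball \<rho> (1/2)"
    proof (rule holomorphic_on_subset[OF holomorphic_zeta])
      show "ball \<rho> (1/2) \<subseteq> - {1}"
        using abs_Im_le_cmod[of "\<rho> - 1"] \<gamma> by (auto simp: dist_norm \<rho>_def)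
    qed
    have sph: "norm (zeta w) \<le> C * \<gamma>" if "w \<in> sphere \<rho> (1/4)" for w
    proof (rule zb)
      show "Re w \<ge> 1/4" "\<bar>Im w - \<gamma>\<bar> \<le> 1/4"
        using that \<beta> abs_Re_le_cmod[of "\<rho> - w"] abs_Im_le_cmod[of "\<rho> - w"]
        by (simp_all add: dist_norm \<rho>_def abs_minus_commute)
    qed (use \<gamma> in simp)
    \<comment> \<open>The point at height \<open>\<alpha>\<close> above \<open>\<rho>\<close> lies
      in the disc of radius 1/4 because \<open>\<alpha> \<le> 2 * \<delta> < 1/4\<close>, and the
      ratio of radii is \<open>4 * \<alpha> \<le> 8 * \<delta>\<close>.\<close>
    have F: "F \<alpha> \<le> B powr k" if \<alpha>: "\<alpha> \<in> {\<delta>..2*\<delta>}" for \<alpha>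
    proof -
      have d: "dist \<rho> (\<rho> + \<i> * of_real \<alpha>) = \<alpha>"
        using \<alpha> \<delta> by (simp add: dist_norm norm_mult)
      have "norm (zeta (\<rho> + \<i> * of_real \<alpha>))
          \<le> (dist \<rho> (\<rho> + \<i> * of_real \<alpha>) / (1/4)) ^ r * (C * \<gamma>)"
        by (rule norm_le_of_high_order_zero[OF hol _ _ zero sph]) (use d \<alpha> \<delta> in simp_all)
      also have "\<dots> \<le> B"
        unfolding B_def d using \<alpha> \<delta> C \<gamma> by (intro mult_right_mono power_mono) auto
      finally show ?thesis unfolding F_def using k by (intro powr_mono2) auto
    qed
    have lF: "l \<le> integral {\<delta>..2*\<delta>} F" using int by (simp add: F_def \<rho>_def)
    \<comment> \<open>The integral of a non-integrable function is 0 by default, which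
      \<open>l > 0\<close> excludes.\<close>
    then have "F integrable_on {\<delta>..2*\<delta>}"
      using l not_integrable_integral[of F "{\<delta>..2*\<delta>}"] by fastforce
    then have "integral {\<delta>..2*\<delta>} F \<le> integral {\<delta>..2*\<delta>} (\<lambda>_. B powr k)"
      using F by (intro integral_le) auto
    also have "\<dots> = \<delta> * B powr k" using \<delta> by simp
    \<comment> \<open>Discarding the interval length \<open>\<delta> < 1\<close> avoids a term
      \<open>ln \<delta> / k\<close>.\<close>
    also have "\<dots> \<le> 1 * B powr k" using \<delta> by (intro mult_right_mono) auto
    finally have "l \<le> B powr k" using lF by simp
    then have "ln l \<le> k * ln B" using l B by (metis ln_mono ln_powr)
    then have "1 / k * ln l \<le> ln B" using k by (simp add: field_simps)
    also have "ln B = ln C + ln \<gamma> - real r * ln (1 / (8 * \<delta>))"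
      unfolding B_def using \<delta> C \<gamma> by (simp add: ln_mult ln_realpow ln_div algebra_simps)
    finally have "real r * ln (1 / (8 * \<delta>)) \<le> ln \<gamma> - 1 / k * ln l + ln C" by simp
    \<comment> \<open>Here \<open>\<delta> < 1/8\<close> is decisive: dividing by this logarithm
      keeps the direction of the inequality.\<close>
    moreover have "ln (1 / (8 * \<delta>)) > 0" using \<delta> by (intro ln_gt_zero) (simp add: field_simps)
    ultimately show ?thesis by (simp add: r_def \<rho>_def field_simps)
  qed
  show ?thesis
  \<comment> \<open>The absolute value is taken because \<open>ln C\<close> may have either sign;
    the second error term is simply 0.\<close>
  proof (rule exI[of _ 1], rule conjI[OF zero_less_one],
      rule exI[of _ "\<bar>ln C\<bar>"], rule exI[of _ 0], intro allI impI)
    fix \<beta> \<gamma> k \<delta> l :: real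
    assume *: "\<beta> \<ge> 1/2" "\<gamma> > 1" "zeta (Complex \<beta> \<gamma>) = 0" "k > 0" "0 < \<delta>" "\<delta> < 1/8" "l > 0"
      "integral {\<delta>..2*\<delta>} (\<lambda>\<alpha>. norm (zeta (Complex \<beta> \<gamma> + \<i> * of_real \<alpha>)) powr k) \<ge> l"
    show "\<exists>E1 E2. \<bar>E1\<bar> \<le> \<bar>ln C\<bar> \<and> \<bar>E2\<bar> \<le> 0 \<and>
        real (zeta_mult (Complex \<beta> \<gamma>)) \<le> 1 / ln (1 / (8*\<delta>)) * (ln \<gamma> - 1/k * ln l + E1) + E2"
      by (rule exI[of _ "ln C"], rule exI[of _ 0]) (use main[OF *] in simp)
  qed
qed

end
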